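(* Consider the symmetric $N$-provider game with parameters $B>0$, $W>0$, $\alpha\in(0,1]$, $\beta\in[0,1]$. In the limit $N\to\infty$, the (limiting equilibrium) consumer surplus, as a function of $\beta\in[0,1]$, is maximized at $\beta=1$, whereas the (limiting equilibrium) total revenue and social welfare, as functions of $\beta\in[0,1]$, are maximized at $\beta=0$.
   Context: There are $N$ symmetric service providers (SPs). Each SP has $B/N$ units of always-available proprietary bandwidth. A shared band of bandwidth $W$ is available with probability $\alpha$; a part $\beta W$ is open access to all SPs and the rest $(1-\beta)W$ is split equally as licensed bandwidth, $(1-\beta)W/N$ per SP. SP $i$ chooses $x_i\ge0$ (traffic on its own licensed bands, including the licensed part of the shared band) and $w_i\ge 0$ (traffic on the open access band; when $\beta=0$ there is no open access band and $w_i=0$). The delivered price is $p_d=1-\sum_j(x_j+w_j)$, the prices obtained by SP $i$ are $$p_i=p_d-(1-\alpha)\frac{N(x_i+w_i)}{B}-\alpha\frac{N x_i}{B+(1-\beta)W},\qquad p_i^w=p_d-\alpha\frac{\sum_j w_j}{\beta W}-(1-\alpha)\frac{N(x_i+w_i)}{B},$$ and SP $i$ maximizes its revenue $R_i=p_ix_i+p_i^ww_i$. The game has a unique Nash equilibrium, which is symmetric. Total revenue is $\sum_i R_i$ at equilibrium; consumer surplus is $z^2/2$, where $z=\sum_j(x_j+w_j)$ is the total equilibrium traffic; social welfare is consumer surplus plus total revenue. The "limiting" quantities are the limits of these as $N\to\infty$ for fixed $B,W,\alpha,\beta$. *)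

theory Defs
  imports Complex_Main "HOL-Library.FuncSet"
begin

text \<open>
  The providers are the indices below \<open>N\<close>. A strategy is a pair \<open>(x, w)\<close> of licensed-band and
  open-access traffic.
\<close>

definition strategies :: "real \<Rightarrow> (real \<times> real) set" where
  "strategies \<beta> = {(x, w). 0 \<le> x \<and> 0 \<le> w \<and> (\<beta> = 0 \<longrightarrow> w = 0)}"

text \<open>Profiles are extensional, so that uniqueness of an equilibrium is not spoiled by
  irrelevant values at indices \<open>\<ge> N\<close>.\<close>

definition profiles :: "nat \<Rightarrow> real \<Rightarrow> (nat \<Rightarrow> real \<times> real) set" where
  "profiles N \<beta> = {..<N} \<rightarrow>\<^sub>E strategies \<beta>"

definition total_traffic :: "nat \<Rightarrow> (nat \<Rightarrow> real \<times> real) \<Rightarrow> real" where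
  "total_traffic N s = (\<Sum>j<N. fst (s j) + snd (s j))"

definition delivered_price :: "nat \<Rightarrow> (nat \<Rightarrow> real \<times> real) \<Rightarrow> real" where
  "delivered_price N s = 1 - total_traffic N s"

definition licensed_price ::
    "real \<Rightarrow> real \<Rightarrow> real \<Rightarrow> real \<Rightarrow> nat \<Rightarrow> (nat \<Rightarrow> real \<times> real) \<Rightarrow> nat \<Rightarrow> real" where
  "licensed_price B W \<alpha> \<beta> N s i =
     delivered_price N s
     - (1 - \<alpha>) * (real N * (fst (s i) + snd (s i)) / B)
     - \<alpha> * (real N * fst (s i) / (B + (1 - \<beta>) * W))"

text \<open>For \<open>\<beta> = 0\<close> the congestion term below is a division by zero; this value is immaterial, since
  the price is only ever multiplied by \<open>w\<^sub>i = 0\<close> in that case.\<close>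

definition open_access_price ::
    "real \<Rightarrow> real \<Rightarrow> real \<Rightarrow> real \<Rightarrow> nat \<Rightarrow> (nat \<Rightarrow> real \<times> real) \<Rightarrow> nat \<Rightarrow> real" where
  "open_access_price B W \<alpha> \<beta> N s i =
     delivered_price N s
     - \<alpha> * ((\<Sum>j<N. snd (s j)) / (\<beta> * W))
     - (1 - \<alpha>) * (real N * (fst (s i) + snd (s i)) / B)"

definition revenue ::
    "real \<Rightarrow> real \<Rightarrow> real \<Rightarrow> real \<Rightarrow> nat \<Rightarrow> (nat \<Rightarrow> real \<times> real) \<Rightarrow> nat \<Rightarrow> real" where
  "revenue B W \<alpha> \<beta> N s i =
     licensed_price B W \<alpha> \<beta> N s i * fst (s i) + open_access_price B W \<alpha> \<beta> N s i * snd (s i)"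

definition nash_equilibrium ::
    "real \<Rightarrow> real \<Rightarrow> real \<Rightarrow> real \<Rightarrow> nat \<Rightarrow> (nat \<Rightarrow> real \<times> real) \<Rightarrow> bool" where
  "nash_equilibrium B W \<alpha> \<beta> N s \<longleftrightarrow>
     s \<in> profiles N \<beta> \<and>
     (\<forall>i<N. \<forall>d\<in>strategies \<beta>. revenue B W \<alpha> \<beta> N (s(i := d)) i \<le> revenue B W \<alpha> \<beta> N s i)"

definition equilibrium ::
    "real \<Rightarrow> real \<Rightarrow> real \<Rightarrow> real \<Rightarrow> nat \<Rightarrow> nat \<Rightarrow> real \<times> real" where
  "equilibrium B W \<alpha> \<beta> N = (THE s. nash_equilibrium B W \<alpha> \<beta> N s)"

definition eq_consumer_surplus :: "real \<Rightarrow> real \<Rightarrow> real \<Rightarrow> real \<Rightarrow> nat \<Rightarrow> real" where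
  "eq_consumer_surplus B W \<alpha> \<beta> N = (total_traffic N (equilibrium B W \<alpha> \<beta> N))\<^sup>2 / 2"

definition eq_total_revenue :: "real \<Rightarrow> real \<Rightarrow> real \<Rightarrow> real \<Rightarrow> nat \<Rightarrow> real" where
  "eq_total_revenue B W \<alpha> \<beta> N = (\<Sum>i<N. revenue B W \<alpha> \<beta> N (equilibrium B W \<alpha> \<beta> N) i)"

definition eq_social_welfare :: "real \<Rightarrow> real \<Rightarrow> real \<Rightarrow> real \<Rightarrow> nat \<Rightarrow> real" where
  "eq_social_welfare B W \<alpha> \<beta> N = eq_consumer_surplus B W \<alpha> \<beta> N + eq_total_revenue B W \<alpha> \<beta> N"

definition limit_consumer_surplus :: "real \<Rightarrow> real \<Rightarrow> real \<Rightarrow> real \<Rightarrow> real" where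
  "limit_consumer_surplus B W \<alpha> \<beta> = lim (eq_consumer_surplus B W \<alpha> \<beta>)"

definition limit_total_revenue :: "real \<Rightarrow> real \<Rightarrow> real \<Rightarrow> real \<Rightarrow> real" where
  "limit_total_revenue B W \<alpha> \<beta> = lim (eq_total_revenue B W \<alpha> \<beta>)"

definition limit_social_welfare :: "real \<Rightarrow> real \<Rightarrow> real \<Rightarrow> real \<Rightarrow> real" where
  "limit_social_welfare B W \<alpha> \<beta> = lim (eq_social_welfare B W \<alpha> \<beta>)"

end

theory Submission
  imports Defs
begin

text \<open>
  The revenue of a provider is a concave quadratic function of its own strategy, so an equilibrium
  is the same as a solution of the variational inequality given by the marginal revenues. These
  form a strictly monotone affine map, whence uniqueness; a symmetric solution of the first-order
  conditions is explicit. Writing \<open>S = B + W\<close>, \<open>u = S + \<beta> W\<close> and \<open>e = (1 - \<alpha>) / B\<close>, the total traffic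
  tends to \<open>u / ((1 + 2 e) u + 2 \<alpha>)\<close> and the total revenue to
  \<open>(e u\<^sup>2 + \<alpha> (2 S - u)) / ((1 + 2 e) u + 2 \<alpha>)\<^sup>2\<close>. The former increases with \<open>u\<close>. For revenue and
  welfare, the difference between the values at \<open>S\<close> and at \<open>u\<close> factors as \<open>u - S\<close> times an expression
  that is nonnegative because \<open>u \<le> 2 S\<close>.
\<close>

section \<open>Scaling, convexity and one-point updates of sums\<close>

text \<open>Divide by \<open>t\<close> and let \<open>t\<close> tend to 0. This turns optimality
  along a segment into a first-order condition.\<close>

lemma nonpos_if_le_all_scaled:
  fixes a q :: real
  assumes "\<And>t. 0 < t \<Longrightarrow> t \<le> 1 \<Longrightarrow> t * a \<le> t\<^sup>2 * q"
  shows "a \<le> 0"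
proof (rule ccontr)
  assume "\<not> a \<le> 0"
  then have a: "a > 0" by simp
  \<comment> \<open>This choice ensures \<open>t * (\<bar>q\<bar> + 1) \<le> a / 2\<close>, whatever
    the sign of \<open>q\<close>.\<close>
  define t where "t = min 1 (a / (2 * (\<bar>q\<bar> + 1)))"
  have t: "0 < t" "t \<le> 1" using a by (auto simp: t_def)
  have "t * a \<le> t * (t * q)" using assms[OF t] by (simp add: power2_eq_square mult.assoc)
  then have "a \<le> t * q" using t by simp
  also have "\<dots> \<le> t * (\<bar>q\<bar> + 1)" using t by (intro mult_left_mono) auto
  also have "\<dots> \<le> a / (2 * (\<bar>q\<bar> + 1)) * (\<bar>q\<bar> + 1)"
    by (intro mult_right_mono) (auto simp: t_def)
  also have "\<dots> = a / 2" by (simp add: field_simps)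
  finally show False using a by simp
qed

lemma strategies_convex:
  assumes "p \<in> strategies \<beta>" "d \<in> strategies \<beta>" "0 < t" "t \<le> 1"
  shows "(fst p + t * (fst d - fst p), snd p + t * (snd d - snd p)) \<in> strategies \<beta>"
proof -
  have *: "0 \<le> a + t * (b - a)" if "0 \<le> a" "0 \<le> b" for a b :: real
  proof -
    have "a + t * (b - a) = (1 - t) * a + t * b" by (simp add: algebra_simps)
    then show ?thesis using that assms(3,4) by simp
  qed
  show ?thesis
    using assms(1,2) *[of "fst p" "fst d"] *[of "snd p" "snd d"] by (auto simp: strategies_def)
qed

lemma sum_fun_upd:
  fixes h :: "'b \<Rightarrow> real" and N :: nat
  assumes "i < N"
  shows "(\<Sum>j<N. h ((s(i := d)) j)) = (\<Sum>j<N. h (s j)) + (h d - h (s i))"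
proof -
  have *: "(\<Sum>j\<in>{..<N} - {i}. h ((s(i := d)) j)) = (\<Sum>j\<in>{..<N} - {i}. h (s j))"
    by (intro sum.cong) auto
  have "(\<Sum>j<N. f j) = f i + (\<Sum>j\<in>{..<N} - {i}. f j)" for f :: "nat \<Rightarrow> real"
    by (rule sum.remove) (use assms in auto)
  from this[of "\<lambda>j. h ((s(i := d)) j)"] this[of "\<lambda>j. h (s j)"] * show ?thesis by simp
qed

section \<open>Revenue as a quadratic function of the own strategy\<close>

locale spectrum_market =
  fixes B W \<alpha> \<beta> :: real
  assumes B_pos: "B > 0" and W_pos: "W > 0" and \<alpha>_pos: "0 < \<alpha>" and \<alpha>_le: "\<alpha> \<le> 1"
    and \<beta>_nonneg: "0 \<le> \<beta>" and \<beta>_le: "\<beta> \<le> 1"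
begin

text \<open>The constants behind the congestion terms: \<open>e\<close> belongs to the state without
  the shared band; when that band is available, \<open>b\<close> is the proprietary plus licensed
  bandwidth of all providers and \<open>g\<close> the open-access bandwidth. For
  \<open>\<beta> = 0\<close> one has \<open>g = 0\<close>, hence
  \<open>\<alpha> / g = 0\<close>.\<close>

definition e :: real where "e = (1 - \<alpha>) / B"
definition b :: real where "b = B + (1 - \<beta>) * W"
definition g :: real where "g = \<beta> * W"

abbreviation nash :: "nat \<Rightarrow> (nat \<Rightarrow> real \<times> real) \<Rightarrow> bool" where
  "nash \<equiv> nash_equilibrium B W \<alpha> \<beta>"
abbreviation rev_of :: "nat \<Rightarrow> (nat \<Rightarrow> real \<times> real) \<Rightarrow> nat \<Rightarrow> real" where
  "rev_of \<equiv> revenue B W \<alpha> \<beta>"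

definition open_traffic :: "nat \<Rightarrow> (nat \<Rightarrow> real \<times> real) \<Rightarrow> real" where
  "open_traffic N s = (\<Sum>j<N. snd (s j))"

lemma e_nonneg: "0 \<le> e" and b_pos: "0 < b" and g_nonneg: "0 \<le> g"
  using B_pos W_pos \<alpha>_le \<beta>_nonneg \<beta>_le
  by (auto simp: e_def b_def g_def intro!: add_pos_nonneg)

lemma g_eq_0_iff: "g = 0 \<longleftrightarrow> \<beta> = 0"
  using W_pos by (simp add: g_def)

lemma revenue_eq:
  "rev_of N s i = (1 - total_traffic N s) * (fst (s i) + snd (s i))
     - e * N * (fst (s i) + snd (s i))\<^sup>2 - \<alpha> * N / b * (fst (s i))\<^sup>2
     - \<alpha> / g * open_traffic N s * snd (s i)"
  unfolding revenue_def licensed_price_def open_access_price_def delivered_price_def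
    open_traffic_def[symmetric] b_def[symmetric] g_def[symmetric]
  by (simp add: e_def power2_eq_square diff_divide_distrib add_divide_distrib algebra_simps)

text \<open>The marginals are the partial derivatives of the own revenue, \<open>slope\<close> is
  the derivative in the direction of a deviation, and \<open>curvature\<close> is the negated
  second-order part.\<close>

definition marginal_licensed :: "nat \<Rightarrow> (nat \<Rightarrow> real \<times> real) \<Rightarrow> nat \<Rightarrow> real" where
  "marginal_licensed N s i = 1 - total_traffic N s - (1 + 2 * e * N) * (fst (s i) + snd (s i))
     - 2 * (\<alpha> * N / b) * fst (s i)"

definition marginal_open :: "nat \<Rightarrow> (nat \<Rightarrow> real \<times> real) \<Rightarrow> nat \<Rightarrow> real" where
  "marginal_open N s i = 1 - total_traffic N s - (1 + 2 * e * N) * (fst (s i) + snd (s i))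
     - \<alpha> / g * (open_traffic N s + snd (s i))"

definition slope :: "nat \<Rightarrow> (nat \<Rightarrow> real \<times> real) \<Rightarrow> nat \<Rightarrow> real \<times> real \<Rightarrow> real" where
  "slope N s i d = marginal_licensed N s i * (fst d - fst (s i))
     + marginal_open N s i * (snd d - snd (s i))"

definition curvature :: "nat \<Rightarrow> real \<Rightarrow> real \<Rightarrow> real" where
  "curvature N x w = (1 + e * N) * (x + w)\<^sup>2 + \<alpha> * N / b * x\<^sup>2 + \<alpha> / g * w\<^sup>2"

lemma curvature_nonneg: "0 \<le> curvature N x w"
  using e_nonneg b_pos g_nonneg \<alpha>_pos by (simp add: curvature_def)

lemma curvature_scale: "curvature N (t * x) (t * w) = t\<^sup>2 * curvature N x w"
  unfolding curvature_def by algebra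

text \<open>Second-order Taylor expansion in the own strategy, exact because the revenue is
  quadratic.\<close>

lemma revenue_deviation:
  assumes "i < N"
  shows "rev_of N (s(i := d)) i
    = rev_of N s i + slope N s i d - curvature N (fst d - fst (s i)) (snd d - snd (s i))"
proof -
  have T: "total_traffic N (s(i := d)) = total_traffic N s + (fst d + snd d - (fst (s i) + snd (s i)))"
    unfolding total_traffic_def
    using sum_fun_upd[OF assms, of "\<lambda>p. fst p + snd p"] by simp
  have O: "open_traffic N (s(i := d)) = open_traffic N s + (snd d - snd (s i))"
    unfolding open_traffic_def using sum_fun_upd[OF assms, of snd] by simp
  \<comment> \<open>With the quotients replaced by free coefficients this is a polynomial identity,
    so \<open>g = 0\<close> needs no separate treatment.\<close>
  have gen: "(1 - (Z + (x' + w' - (x + w)))) * (x' + w') - k * (x' + w')\<^sup>2 - c * x'\<^sup>2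
       - q * (Om + (w' - w)) * w'
     = (1 - Z) * (x + w) - k * (x + w)\<^sup>2 - c * x\<^sup>2 - q * Om * w
       + ((1 - Z - (1 + 2 * k) * (x + w) - 2 * c * x) * (x' - x)
          + (1 - Z - (1 + 2 * k) * (x + w) - q * (Om + w)) * (w' - w))
       - ((1 + k) * ((x' - x) + (w' - w))\<^sup>2 + c * (x' - x)\<^sup>2 + q * (w' - w)\<^sup>2)"
    for Z x w x' w' k c q Om :: real
    by algebra
  show ?thesis
    unfolding revenue_eq T O slope_def marginal_licensed_def marginal_open_def curvature_def
    using gen[of "total_traffic N s" "fst d" "snd d" "fst (s i)" "snd (s i)" "e * N" "\<alpha> * N / b"
        "\<alpha> / g" "open_traffic N s"]
    by (simp add: mult.assoc)
qed

section \<open>Variational inequality and uniqueness\<close>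

lemma nash_iff_variational:
  "nash N s \<longleftrightarrow> s \<in> profiles N \<beta> \<and> (\<forall>i<N. \<forall>d\<in>strategies \<beta>. slope N s i d \<le> 0)"
proof (intro iffI conjI allI impI ballI)
  assume n: "nash N s"
  then show s: "s \<in> profiles N \<beta>" by (simp add: nash_equilibrium_def)
  fix i d assume i: "i < N" and d: "d \<in> strategies \<beta>"
  have si: "s i \<in> strategies \<beta>" using s i by (auto simp: profiles_def)
  show "slope N s i d \<le> 0"
  proof (rule nonpos_if_le_all_scaled)
    fix t :: real assume t: "0 < t" "t \<le> 1"
    \<comment> \<open>A partial move towards \<open>d\<close>, feasible by convexity: it scales the
      slope by \<open>t\<close> but the curvature by \<open>t\<^sup>2\<close>.\<close>
    let ?d = "(fst (s i) + t * (fst d - fst (s i)), snd (s i) + t * (snd d - snd (s i)))"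
    have "rev_of N (s(i := ?d)) i \<le> rev_of N s i"
      using n i strategies_convex[OF si d t] by (simp add: nash_equilibrium_def)
    then have "slope N s i ?d \<le> curvature N (t * (fst d - fst (s i))) (t * (snd d - snd (s i)))"
      unfolding revenue_deviation[OF i] by simp
    moreover have "slope N s i ?d = t * slope N s i d"
      by (simp add: slope_def algebra_simps)
    ultimately show "t * slope N s i d
        \<le> t\<^sup>2 * curvature N (fst d - fst (s i)) (snd d - snd (s i))"
      by (simp add: curvature_scale)
  qed
next
  assume "s \<in> profiles N \<beta> \<and> (\<forall>i<N. \<forall>d\<in>strategies \<beta>. slope N s i d \<le> 0)"
  then show "nash N s"
    unfolding nash_equilibrium_def
    by (auto simp: revenue_deviation intro!: add_nonpos_nonpos curvature_nonneg
        order.trans[OF _ curvature_nonneg])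
qed

text \<open>Monotonicity of the negated marginals. The coupling terms have no sign for a single
  \<open>i\<close>; summed over all providers they become squares.\<close>

lemma slope_add_slope:
  "slope N s i (s' i) + slope N s' i (s i)
   = (total_traffic N s - total_traffic N s')
       * ((fst (s i) + snd (s i)) - (fst (s' i) + snd (s' i)))
     + (1 + 2 * e * N) * ((fst (s i) + snd (s i)) - (fst (s' i) + snd (s' i)))\<^sup>2
     + 2 * (\<alpha> * N / b) * (fst (s i) - fst (s' i))\<^sup>2
     + \<alpha> / g * ((open_traffic N s - open_traffic N s') * (snd (s i) - snd (s' i))
        + (snd (s i) - snd (s' i))\<^sup>2)"
proof -
  have gen: "(1 - Z - k * (x + w) - 2 * c * x) * (x' - x)
        + (1 - Z - k * (x + w) - q * (Om + w)) * (w' - w)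
      + ((1 - Z' - k * (x' + w') - 2 * c * x') * (x - x')
        + (1 - Z' - k * (x' + w') - q * (Om' + w')) * (w - w'))
    = (Z - Z') * ((x + w) - (x' + w')) + k * ((x + w) - (x' + w'))\<^sup>2 + 2 * c * (x - x')\<^sup>2
      + q * ((Om - Om') * (w - w') + (w - w')\<^sup>2)" for Z Z' k x x' w w' c q Om Om' :: real
    by algebra
  show ?thesis unfolding slope_def marginal_licensed_def marginal_open_def by (rule gen)
qed

lemma nash_unique:
  assumes "nash N s" "nash N s'"
  shows "s = s'"
proof -
  define \<tau> where "\<tau> i = (fst (s i) + snd (s i)) - (fst (s' i) + snd (s' i))" for i
  define \<omega> where "\<omega> i = snd (s i) - snd (s' i)" for i
  have prof: "s \<in> profiles N \<beta>" "s' \<in> profiles N \<beta>"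
    using assms by (auto simp: nash_iff_variational)
  then have mem: "s i \<in> strategies \<beta>" "s' i \<in> strategies \<beta>" if "i < N" for i
    using that by (auto simp: profiles_def)
  have tot: "total_traffic N s - total_traffic N s' = (\<Sum>i<N. \<tau> i)"
    and opn: "open_traffic N s - open_traffic N s' = (\<Sum>i<N. \<omega> i)"
    by (simp_all add: total_traffic_def open_traffic_def \<tau>_def \<omega>_def sum_subtractf)
  \<comment> \<open>Each equilibrium is tested against the deviation to the other one.\<close>
  have "(\<Sum>i<N. slope N s i (s' i) + slope N s' i (s i)) \<le> 0"
    using assms mem by (intro sum_nonpos add_nonpos_nonpos) (auto simp: nash_iff_variational)
  also have "(\<Sum>i<N. slope N s i (s' i) + slope N s' i (s i))
     = (\<Sum>i<N. \<tau> i)\<^sup>2 + (1 + 2 * e * N) * (\<Sum>i<N. (\<tau> i)\<^sup>2)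
       + 2 * (\<alpha> * N / b) * (\<Sum>i<N. (fst (s i) - fst (s' i))\<^sup>2)
       + \<alpha> / g * ((\<Sum>i<N. \<omega> i)\<^sup>2 + (\<Sum>i<N. (\<omega> i)\<^sup>2))"
    unfolding slope_add_slope tot opn \<tau>_def[symmetric] \<omega>_def[symmetric]
      sum.distrib sum_distrib_left[symmetric]
    by (simp only: power2_eq_square[of "sum _ _"])
  finally have le: "\<dots> \<le> 0" .
  have nn: "0 \<le> (\<Sum>i<N. \<tau> i)\<^sup>2" "0 \<le> (\<Sum>i<N. (\<tau> i)\<^sup>2)"
    "0 \<le> 2 * e * N * (\<Sum>i<N. (\<tau> i)\<^sup>2)"
    "0 \<le> 2 * (\<alpha> * N / b) * (\<Sum>i<N. (fst (s i) - fst (s' i))\<^sup>2)"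
    "0 \<le> \<alpha> / g * (\<Sum>i<N. \<omega> i)\<^sup>2" "0 \<le> \<alpha> / g * (\<Sum>i<N. (\<omega> i)\<^sup>2)"
    using e_nonneg b_pos g_nonneg \<alpha>_pos
    by (auto intro!: mult_nonneg_nonneg divide_nonneg_nonneg sum_nonneg)
  \<comment> \<open>A sum of nonnegative terms that is at most 0 vanishes termwise. The summand 1 in
    \<open>1 + 2 * e * N\<close> controls \<tau> even if \<open>e = 0\<close>.\<close>
  have "(\<Sum>i<N. (\<tau> i)\<^sup>2) = 0" and gz: "\<alpha> / g * (\<Sum>i<N. (\<omega> i)\<^sup>2) = 0"
    using le nn by (simp_all only: distrib_left distrib_right mult_1_left)
  then have \<tau>: "\<tau> i = 0" if "i < N" for i
    using that by (auto simp: sum_nonneg_eq_0_iff)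
  have \<omega>: "\<omega> i = 0" if "i < N" for i
  \<comment> \<open>For \<open>\<beta> = 0\<close> the coefficient \<open>\<alpha> / g\<close> is 0
    and \<open>gz\<close> is void; there feasibility forces both open-access traffics to be
    0.\<close>
  proof (cases "\<beta> = 0")
    case True
    then show ?thesis using mem[OF that] by (auto simp: \<omega>_def strategies_def)
  next
    case False
    then show ?thesis using gz \<alpha>_pos that by (auto simp: g_eq_0_iff sum_nonneg_eq_0_iff)
  qed
  show ?thesis
  proof (rule PiE_ext[OF prof[unfolded profiles_def]])
    fix i assume "i \<in> {..<N}"
    then show "s i = s' i" using \<tau>[of i] \<omega>[of i] by (auto simp: \<tau>_def \<omega>_def prod_eq_iff)
  qed
qed

section \<open>The explicit symmetric equilibrium\<close>

text \<open>Equal marginals put aggregate licensed and open-access traffic in the ratio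
  \<open>r * b\<close> to \<open>2 * g\<close>; the licensed first-order condition then fixes the
  common factor as \<open>1 / den r\<close>.\<close>

definition den :: "real \<Rightarrow> real" where
  "den r = (r + 2 * e) * (r * b + 2 * g) + 2 * \<alpha> * r"

lemma den_pos: "0 < r \<Longrightarrow> 0 < den r"
  using e_nonneg b_pos g_nonneg \<alpha>_pos by (auto simp: den_def intro!: add_pos_pos mult_pos_pos
      add_pos_nonneg)

text \<open>Aggregate licensed and open-access traffic at the equilibrium, where \<open>r\<close> stands for
  \<open>1 + 1 / N\<close>; the limit is the value at \<open>r = 1\<close>.\<close>

definition agg_licensed :: "real \<Rightarrow> real" where "agg_licensed r = r * b / den r"
definition agg_open :: "real \<Rightarrow> real" where "agg_open r = 2 * g / den r"

definition sym_profile :: "nat \<Rightarrow> nat \<Rightarrow> real \<times> real" where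
  "sym_profile N = (\<lambda>i\<in>{..<N}. (agg_licensed (1 + 1 / N) / N, agg_open (1 + 1 / N) / N))"

lemma first_order_licensed:
  assumes "0 < r"
  shows "(r + 2 * e) * (agg_licensed r + agg_open r) + 2 * \<alpha> / b * agg_licensed r = 1"
proof -
  have "(r + 2 * e) * (agg_licensed r + agg_open r) + 2 * \<alpha> / b * agg_licensed r
    = ((r + 2 * e) * (r * b + 2 * g) + 2 * \<alpha> * r) / den r"
    using b_pos by (simp add: agg_licensed_def agg_open_def add_divide_distrib)
       (simp add: algebra_simps add_divide_distrib)
  then show ?thesis using den_pos[OF assms] by (simp add: den_def)
qed

text \<open>The two marginals differ only in these congestion terms, so this equality carries the
  licensed condition over to the open band.\<close>

lemma first_order_open:
  assumes "0 < r" "\<beta> \<noteq> 0"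
  shows "2 * \<alpha> / b * agg_licensed r = \<alpha> / g * (r * agg_open r)"
  using b_pos assms g_eq_0_iff by (simp add: agg_licensed_def agg_open_def)

lemma total_traffic_sym_profile:
  assumes "1 \<le> N"
  shows "total_traffic N (sym_profile N) = agg_licensed (1 + 1 / N) + agg_open (1 + 1 / N)"
  using assms by (simp add: total_traffic_def sym_profile_def distrib_left)

lemma open_traffic_sym_profile:
  assumes "1 \<le> N"
  shows "open_traffic N (sym_profile N) = agg_open (1 + 1 / N)"
  using assms by (simp add: open_traffic_def sym_profile_def)

lemma nash_sym_profile:
  assumes N: "1 \<le> N"
  shows "nash N (sym_profile N)"
  unfolding nash_iff_variational
proof (intro conjI allI impI ballI)
  define r :: real where "r = 1 + 1 / N"
  have r: "0 < r" by (simp add: r_def add_pos_nonneg)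
  have nn: "0 \<le> agg_licensed r / N" "0 \<le> agg_open r / N"
    using den_pos[OF r] r b_pos g_nonneg by (simp_all add: agg_licensed_def agg_open_def)
  have "g = 0 \<Longrightarrow> agg_open r / N = 0" by (simp add: agg_open_def)
  then have w0: "\<beta> = 0 \<Longrightarrow> agg_open r / N = 0" using g_eq_0_iff by blast
  with nn show "sym_profile N \<in> profiles N \<beta>"
    by (auto simp: sym_profile_def profiles_def strategies_def r_def)
  fix i d assume i: "i < N" and d: "d \<in> strategies \<beta>"
  have si: "sym_profile N i = (agg_licensed r / N, agg_open r / N)"
    using i by (simp add: sym_profile_def r_def)
  have rN: "1 / real N = r - 1" by (simp add: r_def)
  \<comment> \<open>Passage from one provider's share to the aggregate: the own-traffic term
    contributes \<open>1 / N\<close>, which is \<open>r - 1\<close>.\<close>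
  have split: "(1 + 2 * e * N) * (y / N + z / N) = (r - 1 + 2 * e) * (y + z)" for y z :: real
    using N unfolding rN[symmetric] by (simp add: field_simps)
  have "marginal_licensed N (sym_profile N) i
      = 1 - (agg_licensed r + agg_open r) - (r - 1 + 2 * e) * (agg_licensed r + agg_open r)
        - 2 * \<alpha> / b * agg_licensed r"
    unfolding marginal_licensed_def total_traffic_sym_profile[OF N] si fst_conv snd_conv split
      r_def[symmetric] using N by simp
  also have "\<dots> = 0" using first_order_licensed[OF r] by (simp add: algebra_simps)
  finally have ml: "marginal_licensed N (sym_profile N) i = 0" .
  have mo: "marginal_open N (sym_profile N) i = 0" if "\<beta> \<noteq> 0"
  proof -
    have "agg_open r + agg_open r / N = r * agg_open r"
      by (simp add: r_def algebra_simps)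
    then have "marginal_open N (sym_profile N) i
      = 1 - (agg_licensed r + agg_open r) - (r - 1 + 2 * e) * (agg_licensed r + agg_open r)
        - \<alpha> / g * (r * agg_open r)"
      unfolding marginal_open_def total_traffic_sym_profile[OF N] open_traffic_sym_profile[OF N]
        si fst_conv snd_conv split r_def[symmetric] by simp
    also have "\<dots> = 0"
      using first_order_licensed[OF r] unfolding first_order_open[OF r that, symmetric]
      by (simp add: algebra_simps)
    finally show ?thesis .
  qed
  \<comment> \<open>For \<open>\<beta> = 0\<close> the open marginal need not vanish, but no
    feasible deviation changes the open-access traffic.\<close>
  have "snd d - snd (sym_profile N i) = 0" if "\<beta> = 0"
    using d w0[OF that] that unfolding si by (auto simp: strategies_def)
  with mo have "marginal_open N (sym_profile N) i * (snd d - snd (sym_profile N i)) = 0"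
    by (metis mult_zero_left mult_zero_right)
  with ml show "slope N (sym_profile N) i d \<le> 0"
    by (simp only: slope_def)
qed

lemma ex1_nash: "1 \<le> N \<Longrightarrow> \<exists>!s. nash N s"
  using nash_sym_profile nash_unique by blast

lemma equilibrium_eq: "1 \<le> N \<Longrightarrow> equilibrium B W \<alpha> \<beta> N = sym_profile N"
  unfolding equilibrium_def using nash_sym_profile nash_unique by blast

section \<open>Limits of the equilibrium quantities\<close>

definition surplus_at :: "real \<Rightarrow> real" where
  "surplus_at r = (agg_licensed r + agg_open r)\<^sup>2 / 2"

definition revenue_at :: "real \<Rightarrow> real" where
  "revenue_at r = (1 - (agg_licensed r + agg_open r)) * (agg_licensed r + agg_open r)
     - e * (agg_licensed r + agg_open r)\<^sup>2 - \<alpha> / b * (agg_licensed r)\<^sup>2 - \<alpha> / g * (agg_open r)\<^sup>2"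

lemma eq_consumer_surplus_eq:
  "1 \<le> N \<Longrightarrow> eq_consumer_surplus B W \<alpha> \<beta> N = surplus_at (1 + 1 / N)"
  by (simp add: eq_consumer_surplus_def equilibrium_eq total_traffic_sym_profile surplus_at_def)

text \<open>Summing \<open>N\<close> equal revenues cancels every explicit factor \<open>N\<close>.
  The dependence on \<open>N\<close> is only through \<open>1 + 1 / N\<close>, so the limit reduces
  to continuity at 1.\<close>

lemma eq_total_revenue_eq:
  assumes "1 \<le> N"
  shows "eq_total_revenue B W \<alpha> \<beta> N = revenue_at (1 + 1 / N)"
proof -
  have gen: "N * ((1 - Z) * (X / N + Y / N) - e * N * (X / N + Y / N)\<^sup>2
      - \<alpha> * N / b * (X / N)\<^sup>2 - \<alpha> / g * Y * (Y / N))
    = (1 - Z) * (X + Y) - e * (X + Y)\<^sup>2 - \<alpha> / b * X\<^sup>2 - \<alpha> / g * Y\<^sup>2" for X Y Z :: real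
    unfolding add_divide_distrib[symmetric]
    using assms by (simp add: right_diff_distrib power2_eq_square)
  show ?thesis
    unfolding eq_total_revenue_def equilibrium_eq[OF assms] revenue_eq
      total_traffic_sym_profile[OF assms] open_traffic_sym_profile[OF assms] revenue_at_def
      gen[of "agg_licensed (1 + 1 / N) + agg_open (1 + 1 / N)", symmetric]
    by (simp add: sym_profile_def)
qed

lemma tendsto_r: "(\<lambda>N. 1 + 1 / real N) \<longlonglongrightarrow> 1"
  using tendsto_add[OF tendsto_const[of 1] lim_1_over_n[where 'a=real]] by simp

lemma isCont_at_1: "isCont agg_licensed 1" "isCont agg_open 1"
  using den_pos[of 1] unfolding agg_licensed_def[abs_def] agg_open_def[abs_def] den_def[abs_def]
  by (auto intro!: continuous_intros)

lemma tendsto_surplus: "eq_consumer_surplus B W \<alpha> \<beta> \<longlonglongrightarrow> surplus_at 1"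
proof (rule Lim_transform_eventually)
  have "isCont surplus_at 1"
    unfolding surplus_at_def[abs_def] by (intro continuous_intros isCont_at_1) simp
  then show "(\<lambda>N. surplus_at (1 + 1 / real N)) \<longlonglongrightarrow> surplus_at 1"
    by (rule isCont_tendsto_compose) (rule tendsto_r)
  show "\<forall>\<^sub>F N in sequentially. surplus_at (1 + 1 / real N) = eq_consumer_surplus B W \<alpha> \<beta> N"
    using eventually_ge_at_top[of 1] by eventually_elim (simp add: eq_consumer_surplus_eq)
qed

lemma tendsto_revenue: "eq_total_revenue B W \<alpha> \<beta> \<longlonglongrightarrow> revenue_at 1"
proof (rule Lim_transform_eventually)
  have "isCont revenue_at 1"
    unfolding revenue_at_def[abs_def] by (intro continuous_intros isCont_at_1)
  then show "(\<lambda>N. revenue_at (1 + 1 / real N)) \<longlonglongrightarrow> revenue_at 1"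
    by (rule isCont_tendsto_compose) (rule tendsto_r)
  show "\<forall>\<^sub>F N in sequentially. revenue_at (1 + 1 / real N) = eq_total_revenue B W \<alpha> \<beta> N"
    using eventually_ge_at_top[of 1] by eventually_elim (simp add: eq_total_revenue_eq)
qed

lemma tendsto_welfare: "eq_social_welfare B W \<alpha> \<beta> \<longlonglongrightarrow> surplus_at 1 + revenue_at 1"
  unfolding eq_social_welfare_def[abs_def] by (intro tendsto_add tendsto_surplus tendsto_revenue)

lemma traffic_at_1:
  "agg_licensed 1 + agg_open 1
   = (B + W + \<beta> * W) / ((1 + 2 * e) * (B + W + \<beta> * W) + 2 * \<alpha>)"
proof -
  \<comment> \<open>At \<open>r = 1\<close> the total traffic depends on \<beta> only through this
    sum, in which open bandwidth counts twice.\<close>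
  have "b + 2 * g = B + W + \<beta> * W" by (simp add: b_def g_def algebra_simps)
  then show ?thesis
    by (simp add: agg_licensed_def agg_open_def den_def add_divide_distrib[symmetric])
qed

lemma revenue_at_1:
  "revenue_at 1 = (e * (B + W + \<beta> * W)\<^sup>2 + \<alpha> * (2 * (B + W) - (B + W + \<beta> * W)))
     / ((1 + 2 * e) * (B + W + \<beta> * W) + 2 * \<alpha>)\<^sup>2"
proof -
  define u where "u = B + W + \<beta> * W"
  define D where "D = (1 + 2 * e) * u + 2 * \<alpha>"
  have u: "b + 2 * g = u" by (simp add: b_def g_def u_def algebra_simps)
  then have D: "den 1 = D" by (simp add: den_def D_def)
  then have D0: "D \<noteq> 0" using den_pos[of 1] by simp
  have z: "agg_licensed 1 + agg_open 1 = u / D"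
    using traffic_at_1 by (simp add: u_def D_def)
  have l: "\<alpha> / b * (agg_licensed 1)\<^sup>2 = \<alpha> * b / D\<^sup>2"
    using b_pos by (simp add: agg_licensed_def D power2_eq_square)
  \<comment> \<open>Both sides are 0 when \<open>g = 0\<close>.\<close>
  have o: "\<alpha> / g * (agg_open 1)\<^sup>2 = 4 * \<alpha> * g / D\<^sup>2"
    by (simp add: agg_open_def D power2_eq_square)
  have "revenue_at 1 = (u * D - u\<^sup>2 - e * u\<^sup>2 - \<alpha> * b - 4 * \<alpha> * g) / D\<^sup>2"
    unfolding revenue_at_def z l o using D0
    by (simp add: diff_divide_distrib power_divide power2_eq_square left_diff_distrib)
  \<comment> \<open>Since \<open>u = b + 2 * g\<close>, the \<alpha> terms collapse to
    \<open>\<alpha> * b\<close>, and \<open>b = 2 * (B + W) - u\<close>.\<close>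
  also have "u * D - u\<^sup>2 - e * u\<^sup>2 - \<alpha> * b - 4 * \<alpha> * g = e * u\<^sup>2 + \<alpha> * (2 * (B + W) - u)"
    unfolding D_def u_def b_def g_def by (simp add: algebra_simps power2_eq_square)
  finally show ?thesis by (simp add: D_def u_def)
qed

end

section \<open>Maximization over \<beta>\<close>

text \<open>The ratio equals \<open>1 / (A + 2 * \<alpha> / u)\<close>, which increases with
  \<open>u\<close>.\<close>

lemma surplus_ratio_mono:
  fixes u v A \<alpha> :: real
  assumes "0 < u" "u \<le> v" "0 < A" "0 < \<alpha>"
  shows "(u / (A * u + 2 * \<alpha>))\<^sup>2 / 2 \<le> (v / (A * v + 2 * \<alpha>))\<^sup>2 / 2"
proof -
  have "0 < A * u + 2 * \<alpha>" "0 < A * v + 2 * \<alpha>"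
    using assms by (auto intro!: add_pos_pos)
  moreover from this have "u / (A * u + 2 * \<alpha>) \<le> v / (A * v + 2 * \<alpha>)"
    using assms by (simp add: divide_simps) (simp add: algebra_simps)
  ultimately show ?thesis using assms by (simp add: power_mono)
qed

text \<open>The case \<open>h = e\<close> is the limiting revenue, the case \<open>h = e + 1 / 2\<close> the limiting welfare.\<close>

lemma quadratic_ratio_le:
  fixes S u e h \<alpha> :: real
  assumes "0 < S" "S \<le> u" "u \<le> 2 * S" "0 \<le> e" "0 < \<alpha>" and h: "h = e \<or> h = e + 1 / 2"
  shows "(h * u\<^sup>2 + \<alpha> * (2 * S - u)) / ((1 + 2 * e) * u + 2 * \<alpha>)\<^sup>2
    \<le> (h * S\<^sup>2 + \<alpha> * (2 * S - S)) / ((1 + 2 * e) * S + 2 * \<alpha>)\<^sup>2"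
proof -
  define A where "A = 1 + 2 * e"
  \<comment> \<open>The cofactor left when \<open>\<alpha> * (u - S)\<close> is divided out of the
    cross-multiplied difference of the two sides.\<close>
  define K where "K = A\<^sup>2 * S * (u + 2 * S) + 4 * A * S * (2 * \<alpha> - h * u) + 4 * \<alpha> * (\<alpha> - h * (S + u))"
  have dens: "0 < A * u + 2 * \<alpha>" "0 < A * S + 2 * \<alpha>"
    using assms by (auto simp: A_def intro!: add_pos_pos)
  have "0 \<le> K"
    using h
  proof
    assume h: "h = e"
    \<comment> \<open>The terms are grouped so that the only negative contributions sit in
      \<open>2 * S - u\<close>, which is nonnegative.\<close>
    have "K = 4 * e\<^sup>2 * S * (2 * S - u) + 4 * e * (2 * S\<^sup>2 + \<alpha> * S + \<alpha> * (2 * S - u))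
        + S * (u + 2 * S) + 8 * \<alpha> * S + 4 * \<alpha>\<^sup>2"
      unfolding K_def A_def h by algebra
    also have "\<dots> \<ge> 0" using assms by (intro add_nonneg_nonneg mult_nonneg_nonneg) auto
    finally show ?thesis .
  next
    assume "h = e + 1 / 2"
    then have h: "h = A / 2" by (simp add: A_def)
    have "K = A\<^sup>2 * S * (2 * S - u) + 2 * \<alpha> * A * (3 * S - u) + 4 * \<alpha>\<^sup>2"
      unfolding K_def h by (simp add: algebra_simps power2_eq_square)
    also have "\<dots> \<ge> 0"
      using assms by (intro add_nonneg_nonneg mult_nonneg_nonneg) (auto simp: A_def)
    finally show ?thesis .
  qed
  then have "0 \<le> \<alpha> * (u - S) * K" using assms by simp
  also have "\<dots> = (h * S\<^sup>2 + \<alpha> * (2 * S - S)) * (A * u + 2 * \<alpha>)\<^sup>2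
      - (h * u\<^sup>2 + \<alpha> * (2 * S - u)) * (A * S + 2 * \<alpha>)\<^sup>2"
    unfolding K_def by algebra
  finally show ?thesis
    unfolding A_def[symmetric] using dens by (simp add: frac_le_eq divide_le_0_iff)
qed

text \<open>The first two conjuncts guarantee that \<open>THE\<close> and \<open>lim\<close> in the
  definitions denote the actual equilibrium and actual limits.\<close>

theorem theorem4p3:
  fixes B W \<alpha> :: real
  assumes "B > 0" and "W > 0" and "0 < \<alpha>" and "\<alpha> \<le> 1"
  shows "(\<forall>\<beta>\<in>{0..1}. \<forall>N\<ge>1. \<exists>!s. nash_equilibrium B W \<alpha> \<beta> N s)
    \<and> (\<forall>\<beta>\<in>{0..1}. convergent (eq_consumer_surplus B W \<alpha> \<beta>)
          \<and> convergent (eq_total_revenue B W \<alpha> \<beta>)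
          \<and> convergent (eq_social_welfare B W \<alpha> \<beta>))
    \<and> is_arg_max (limit_consumer_surplus B W \<alpha>) (\<lambda>\<beta>. \<beta> \<in> {0..1}) 1
    \<and> is_arg_max (limit_total_revenue B W \<alpha>) (\<lambda>\<beta>. \<beta> \<in> {0..1}) 0
    \<and> is_arg_max (limit_social_welfare B W \<alpha>) (\<lambda>\<beta>. \<beta> \<in> {0..1}) 0"
proof -
  have market: "spectrum_market B W \<alpha> \<beta>" if "\<beta> \<in> {0..1}" for \<beta>
    using that assms by unfold_locales auto
  define c where "c = (1 - \<alpha>) / B"
  define S where "S = B + W"
  define u where "u \<beta> = S + \<beta> * W" for \<beta>
  define ratio where "ratio h v = (h * v\<^sup>2 + \<alpha> * (2 * S - v)) / ((1 + 2 * c) * v + 2 * \<alpha>)\<^sup>2" for h v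
  have c: "0 \<le> c" and S: "0 < S" using assms by (auto simp: c_def S_def)
  have u: "S \<le> u \<beta>" "u \<beta> \<le> 2 * S" "u \<beta> \<le> u 1" if "\<beta> \<in> {0..1}" for \<beta>
  proof -
    have "0 \<le> \<beta> * W" and le: "\<beta> * W \<le> W"
      using that assms(2) by auto
    then show "S \<le> u \<beta>" by (simp add: u_def)
    show "u \<beta> \<le> u 1" using le by (simp only: u_def mult_1_left add_left_mono)
    show "u \<beta> \<le> 2 * S"
      using add_mono[OF le less_imp_le[OF assms(1)]] by (simp add: u_def S_def add.commute)
  qed
  have cs: "limit_consumer_surplus B W \<alpha> \<beta> = (u \<beta> / ((1 + 2 * c) * u \<beta> + 2 * \<alpha>))\<^sup>2 / 2"
    if "\<beta> \<in> {0..1}" for \<beta>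
  proof -
    interpret spectrum_market B W \<alpha> \<beta> by (rule market[OF that])
    show ?thesis
      unfolding limit_consumer_surplus_def limI[OF tendsto_surplus] surplus_at_def traffic_at_1
      by (simp add: u_def S_def c_def e_def)
  qed
  have tr: "limit_total_revenue B W \<alpha> \<beta> = ratio c (u \<beta>)" if "\<beta> \<in> {0..1}" for \<beta>
  proof -
    interpret spectrum_market B W \<alpha> \<beta> by (rule market[OF that])
    show ?thesis
      unfolding limit_total_revenue_def limI[OF tendsto_revenue] revenue_at_1
      by (simp add: ratio_def u_def S_def c_def e_def)
  qed
  have sw: "limit_social_welfare B W \<alpha> \<beta> = ratio (c + 1 / 2) (u \<beta>)" if "\<beta> \<in> {0..1}" for \<beta>
  proof -
    interpret spectrum_market B W \<alpha> \<beta> by (rule market[OF that])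
    have "limit_social_welfare B W \<alpha> \<beta>
        = limit_consumer_surplus B W \<alpha> \<beta> + limit_total_revenue B W \<alpha> \<beta>"
      unfolding limit_social_welfare_def limit_consumer_surplus_def limit_total_revenue_def
        limI[OF tendsto_surplus] limI[OF tendsto_revenue] limI[OF tendsto_welfare] ..
    \<comment> \<open>The surplus is half the squared traffic over the same squared denominator, so
      it raises the coefficient of \<open>v\<^sup>2\<close> by \<open>1 / 2\<close>.\<close>
    then show ?thesis
      by (simp add: cs[OF that] tr[OF that] ratio_def power_divide add_divide_distrib distrib_right)
  qed
  have "\<exists>!s. nash_equilibrium B W \<alpha> \<beta> N s" if "\<beta> \<in> {0..1}" "1 \<le> N" for \<beta> N
    using spectrum_market.ex1_nash[OF market] that by blast
  moreover have "convergent (eq_consumer_surplus B W \<alpha> \<beta>)" "convergent (eq_total_revenue B W \<alpha> \<beta>)"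
      "convergent (eq_social_welfare B W \<alpha> \<beta>)" if "\<beta> \<in> {0..1}" for \<beta>
    using spectrum_market.tendsto_surplus[OF market[OF that]]
      spectrum_market.tendsto_revenue[OF market[OF that]]
      spectrum_market.tendsto_welfare[OF market[OF that]]
    by (auto simp: convergent_def)
  moreover have "limit_consumer_surplus B W \<alpha> \<beta> \<le> limit_consumer_surplus B W \<alpha> 1"
    if "\<beta> \<in> {0..1}" for \<beta>
  proof -
    have one: "1 \<in> {0..1::real}" by simp
    show ?thesis
      unfolding cs[OF that] cs[OF one]
      by (rule surplus_ratio_mono) (use u[OF that] S c assms(3) in linarith)+
  qed
  then have "is_arg_max (limit_consumer_surplus B W \<alpha>) (\<lambda>\<beta>. \<beta> \<in> {0..1}) 1"
    unfolding is_arg_max_linorder by simp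
  \<comment> \<open>Here \<open>u 0 = S\<close>, so the comparison value \<open>S\<close> is the one
    at \<open>\<beta> = 0\<close>.\<close>
  moreover have "ratio h (u \<beta>) \<le> ratio h (u 0)" if "\<beta> \<in> {0..1}" "h = c \<or> h = c + 1 / 2" for \<beta> h
    using quadratic_ratio_le[OF S u(1,2)[OF that(1)] c assms(3) that(2)]
    by (simp add: ratio_def u_def)
  then have "is_arg_max (limit_total_revenue B W \<alpha>) (\<lambda>\<beta>. \<beta> \<in> {0..1}) 0"
    "is_arg_max (limit_social_welfare B W \<alpha>) (\<lambda>\<beta>. \<beta> \<in> {0..1}) 0"
    unfolding is_arg_max_linorder by (simp_all add: tr sw)
  ultimately show ?thesis by blast
qed

end
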